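(* Let $n\ge 1$ and let $x_1,\dots,x_{2n},y_1,\dots,y_{2n},\lambda$ be indeterminates. Then $$\operatorname{Pf}_\lambda(x_i-y_j)_{1\le i<j\le 2n}=\left(\prod_{k=1}^{n-1}(1-\lambda\sigma_{2k})\right)\left(\prod_{i=1}^n(x_{2i-1}-y_{2i})\right),$$ where the product of the operators $1-\lambda\sigma_{2k}$ (composition) is applied to the polynomial $\prod_{i=1}^n(x_{2i-1}-y_{2i})$, and $\sigma_k$ is the linear and multiplicative operator (i.e. the $\mathbb Z[\lambda]$-algebra endomorphism of $\mathbb Z[\lambda][x_1,\dots,x_{2n},y_1,\dots,y_{2n}]$) with $\sigma_k(x_{k+1})=y_{k+1}$, $\sigma_k(y_k)=x_k$, $\sigma_k(x_i)=x_i$ for $i\ne k+1$, and $\sigma_k(y_i)=y_i$ for $i\ne k$.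
   Context: For an array $(A_{ij})_{1\le i<j\le 2n}$ (the strictly upper triangular part of a skew-symmetric matrix of size $2n$), the $\lambda$-Pfaffian is $$\operatorname{Pf}_\lambda(A_{ij})_{1\le i<j\le 2n}=\sum_{m\in\mathcal M([2n])}(-1)^{\mathrm{cross}(m)}\,\lambda^{\mathrm{cross}(m)+\mathrm{nest}(m)}\prod_{i=1}^n A_{m_{2i-1}m_{2i}}.$$ Here $\mathcal M([2n])$ is the set of perfect matchings of $[2n]=\{1,\dots,2n\}$, written $m=((m_1,m_2),\dots,(m_{2n-1},m_{2n}))$ with $m_{2i-1}<m_{2i}$ for all $i$ and $m_1<m_3<\cdots<m_{2n-1}$. $\mathrm{cross}(m)$ is the number of (unordered) pairs of pairs $(a,b),(c,d)$ in $m$ with $a<c<b<d$; $\mathrm{nest}(m)$ is the number of pairs of pairs $(a,b),(c,d)$ in $m$ with $a<c<d<b$. The operators $\sigma_2,\sigma_4,\dots,\sigma_{2n-2}$ commute pairwise, so the order of composition does not matter; the empty product of operators is the identity. *)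

theory Defs
  imports "HOL-Library.Poly_Mapping" "HOL-Computational_Algebra.Polynomial"
begin

section \<open>The \<open>\<lambda>\<close>-Pfaffian\<close>

text \<open>A perfect matching is encoded as its set of pairs \<open>(a, b)\<close> with \<open>a < b\<close>; ordering these pairs
  by first component gives the usual tuple \<open>((m\<^sub>1, m\<^sub>2), (m\<^sub>3, m\<^sub>4), \<dots>)\<close>.\<close>

definition perfect_matchings :: "nat set \<Rightarrow> (nat \<times> nat) set set" where
  "perfect_matchings S =
     {m. m \<subseteq> S \<times> S \<and> (\<forall>(a, b)\<in>m. a < b) \<and> (\<forall>i\<in>S. \<exists>!p\<in>m. i = fst p \<or> i = snd p)}"

text \<open>The inequality \<open>a < c\<close> selects exactly one ordering of each unordered pair of pairs.\<close>

definition cross :: "(nat \<times> nat) set \<Rightarrow> nat" where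
  "cross m = card {((a, b), (c, d)). (a, b) \<in> m \<and> (c, d) \<in> m \<and> a < c \<and> c < b \<and> b < d}"

definition nest :: "(nat \<times> nat) set \<Rightarrow> nat" where
  "nest m = card {((a, b), (c, d)). (a, b) \<in> m \<and> (c, d) \<in> m \<and> a < c \<and> c < d \<and> d < b}"

text \<open>\<open>Pf l n A\<close> has size \<open>2 * n\<close> and reads only the entries \<open>A i j\<close> with \<open>1 \<le> i < j \<le> 2 * n\<close>.\<close>

definition Pf :: "'a::comm_ring_1 \<Rightarrow> nat \<Rightarrow> (nat \<Rightarrow> nat \<Rightarrow> 'a) \<Rightarrow> 'a" where
  "Pf l n A =
     (\<Sum>m\<in>perfect_matchings {1..2 * n}.
        (-1) ^ cross m * l ^ (cross m + nest m) * (\<Prod>(i, j)\<in>m. A i j))"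

section \<open>The polynomial ring \<open>\<int>[\<lambda>][x\<^sub>i, y\<^sub>i]\<close>\<close>

text \<open>Coefficients are in \<open>\<int>[\<lambda>]\<close>, represented by \<^typ>\<open>int poly\<close>. The ring has variables
  \<open>x\<^sub>i, y\<^sub>i\<close> for all natural \<open>i\<close>, so it contains \<open>\<int>[\<lambda>][x\<^sub>1, \<dots>, x\<^sub>2\<^sub>n, y\<^sub>1, \<dots>, y\<^sub>2\<^sub>n]\<close> for every \<open>n\<close>.
  Its multiplication is the convolution product on \<^typ>\<open>'a \<Rightarrow>\<^sub>0 'b\<close>.\<close>

datatype var = VX nat | VY nat

type_synonym mpol = "(var \<Rightarrow>\<^sub>0 nat) \<Rightarrow>\<^sub>0 int poly"

definition cst :: "int poly \<Rightarrow> mpol" where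
  "cst c = Poly_Mapping.single 0 c"

definition var :: "var \<Rightarrow> mpol" where
  "var v = Poly_Mapping.single (Poly_Mapping.single v 1) 1"

abbreviation X :: "nat \<Rightarrow> mpol" where "X i \<equiv> var (VX i)"

abbreviation Y :: "nat \<Rightarrow> mpol" where "Y i \<equiv> var (VY i)"

definition lam :: mpol where
  "lam = cst [:0, 1:]"

text \<open>The \<open>\<int>[\<lambda>]\<close>-algebra endomorphism sending each variable \<open>v\<close> to \<open>f v\<close>.\<close>

definition subst :: "(var \<Rightarrow> mpol) \<Rightarrow> mpol \<Rightarrow> mpol" where
  "subst f p =
     (\<Sum>m\<in>Poly_Mapping.keys p.
        cst (Poly_Mapping.lookup p m) *
        (\<Prod>v\<in>Poly_Mapping.keys m. f v ^ Poly_Mapping.lookup m v))"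

definition sigma :: "nat \<Rightarrow> mpol \<Rightarrow> mpol" where
  "sigma k = subst (\<lambda>v. if v = VX (k + 1) then Y (k + 1)
                        else if v = VY k then X k
                        else var v)"

subsection \<open>Substitution is an algebra endomorphism\<close>

lemma cst_add: "cst (a + b) = cst a + cst b"
  by (simp add: cst_def single_add)

lemma cst_mult: "cst (a * b) = cst a * cst b"
  by (simp add: cst_def mult_single)

lemma cst_0 [simp]: "cst 0 = 0" and cst_1 [simp]: "cst 1 = 1"
  by (simp_all add: cst_def)

lemma subst_superset:
  assumes "finite A" "Poly_Mapping.keys p \<subseteq> A"
  shows "subst f p = (\<Sum>m\<in>A. cst (Poly_Mapping.lookup p m) *
           (\<Prod>v\<in>Poly_Mapping.keys m. f v ^ Poly_Mapping.lookup m v))"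
  unfolding subst_def using assms
  by (intro sum.mono_neutral_left) (auto simp: in_keys_iff)

lemma subst_add: "subst f (p + q) = subst f p + subst f q"
proof -
  let ?A = "Poly_Mapping.keys p \<union> Poly_Mapping.keys q"
  have "Poly_Mapping.keys (p + q) \<subseteq> ?A" by (rule Poly_Mapping.keys_add)
  then show ?thesis
    by (simp add: subst_superset[of ?A] lookup_add cst_add distrib_right sum.distrib)
qed

lemma subst_single:
  "subst f (Poly_Mapping.single m c) =
     cst c * (\<Prod>v\<in>Poly_Mapping.keys m. f v ^ Poly_Mapping.lookup m v)"
  by (subst subst_superset[of "{m}"]) auto

lemma subst_cst [simp]: "subst f (cst c) = cst c"
  by (simp add: cst_def subst_single)

lemma subst_var [simp]: "subst f (var v) = f v"
  by (simp add: var_def subst_single)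

lemma monomial_superset:
  fixes f :: "var \<Rightarrow> mpol"
  assumes "finite A" "Poly_Mapping.keys m \<subseteq> A"
  shows "(\<Prod>v\<in>Poly_Mapping.keys m. f v ^ Poly_Mapping.lookup m v) =
         (\<Prod>v\<in>A. f v ^ Poly_Mapping.lookup m v)"
  using assms by (intro prod.mono_neutral_left) (auto simp: in_keys_iff)

lemma monomial_add:
  fixes f :: "var \<Rightarrow> mpol"
  shows "(\<Prod>v\<in>Poly_Mapping.keys (m + m'). f v ^ Poly_Mapping.lookup (m + m') v) =
         (\<Prod>v\<in>Poly_Mapping.keys m. f v ^ Poly_Mapping.lookup m v) *
         (\<Prod>v\<in>Poly_Mapping.keys m'. f v ^ Poly_Mapping.lookup m' v)"
proof -
  let ?A = "Poly_Mapping.keys m \<union> Poly_Mapping.keys m'"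
  have "Poly_Mapping.keys (m + m') \<subseteq> ?A" by (rule Poly_Mapping.keys_add)
  then have "(\<Prod>v\<in>Poly_Mapping.keys (m + m'). f v ^ Poly_Mapping.lookup (m + m') v) =
             (\<Prod>v\<in>?A. f v ^ Poly_Mapping.lookup (m + m') v)"
    by (intro monomial_superset) auto
  then show ?thesis
    by (simp add: monomial_superset[of ?A m] monomial_superset[of ?A m'] lookup_add power_add
          prod.distrib)
qed

lemma mpol_induct [case_names single add]:
  fixes p :: mpol
  assumes "\<And>m c. P (Poly_Mapping.single m c)" "\<And>p q. P p \<Longrightarrow> P q \<Longrightarrow> P (p + q)"
  shows "P p"
proof (induction p rule: update_induct)
  case const
  show ?case using assms(1)[of 0 0] by simp
next
  case (update p m c)
  have "Poly_Mapping.update m c p = p + Poly_Mapping.single m c"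
    using update by (intro poly_mapping_eqI)
      (auto simp: lookup_update lookup_add lookup_single in_keys_iff when_def)
  then show ?case using assms update by metis
qed

lemma subst_mult: "subst f (p * q) = subst f p * subst f q"
proof (induction p rule: mpol_induct)
  case (single m c)
  show ?case
    by (induction q rule: mpol_induct)
       (simp_all add: subst_single mult_single cst_mult monomial_add subst_add algebra_simps)
qed (simp add: subst_add distrib_right)

lemma subst_unique:
  assumes "\<And>p q. h (p + q) = h p + h q" "\<And>p q. h (p * q) = h p * h q"
    and "\<And>c. h (cst c) = cst c" "\<And>v. h (var v) = f v"
  shows "h = subst f"
proof
  have h1: "h 1 = 1" using assms(3)[of 1] by simp
  have hpow: "h (p ^ k) = h p ^ k" for p k
    by (induction k) (simp_all add: h1 assms)
  have mono: "h (Poly_Mapping.single m 1) =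
      (\<Prod>v\<in>Poly_Mapping.keys m. f v ^ Poly_Mapping.lookup m v)" for m
  proof (induction m rule: update_induct)
    case const
    show ?case using h1 by simp
  next
    case (update m v k)
    have eq: "Poly_Mapping.update v k m = m + Poly_Mapping.single v k"
      using update by (intro poly_mapping_eqI)
        (auto simp: lookup_update lookup_add lookup_single in_keys_iff when_def)
    have "var v ^ j = Poly_Mapping.single (Poly_Mapping.single v j) 1" for j
      by (induction j) (simp_all add: var_def mult_single flip: single_add)
    then have "h (Poly_Mapping.single (Poly_Mapping.single v k) 1) = f v ^ k"
      by (metis hpow assms(4))
    moreover have "Poly_Mapping.single (m + Poly_Mapping.single v k) (1 :: int poly) =
        Poly_Mapping.single m 1 * Poly_Mapping.single (Poly_Mapping.single v k) 1"
      by (simp add: mult_single)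
    ultimately show ?case
      unfolding eq monomial_add using update by (simp add: assms)
  qed
  fix p show "h p = subst f p"
  proof (induction p rule: mpol_induct)
    case (single m c)
    have "Poly_Mapping.single m c = cst c * Poly_Mapping.single m 1"
      by (simp add: cst_def mult_single)
    then have "h (Poly_Mapping.single m c) = cst c * h (Poly_Mapping.single m 1)"
      by (simp add: assms)
    then show ?case by (simp add: mono subst_single)
  qed (simp add: assms subst_add)
qed

lemma sigma_add: "sigma k (p + q) = sigma k p + sigma k q"
  and sigma_mult: "sigma k (p * q) = sigma k p * sigma k q"
  and sigma_cst: "sigma k (cst c) = cst c"
  and sigma_x: "sigma k (X i) = (if i = k + 1 then Y (k + 1) else X i)"
  and sigma_y: "sigma k (Y i) = (if i = k then X k else Y i)"
  by (simp_all add: sigma_def subst_add subst_mult)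

end

theory Submission
  imports Defs
begin

text \<open>Read the points \<open>1, \<dots>, 2n\<close> from left to right. Each point either opens an arc or closes
  one of the open arcs. Closing the arc opened at \<open>p\<close> when \<open>h\<close> arcs are open contributes
  \<open>\<lambda>\<^sup>h\<^sup>-\<^sup>1\<close> and a sign given by the number of open arcs opened after \<open>p\<close>. Let
  \<open>F L\<close> be the sum over all completions of a state with set \<open>L\<close> of open arcs. For entries
  \<open>x\<^sub>i - y\<^sub>j\<close>, the alternating signs force \<open>F L\<close> to be affine in \<open>x\<^sub>a\<close> for \<open>L = {a}\<close>, a multiple
  of \<open>x\<^sub>a - x\<^sub>b\<close> for \<open>L = {a, b}\<close>, and zero for three or more open arcs. Hence only two kinds
  of steps survive on each pair of points \<open>2k, 2k + 1\<close>: close and reopen, giving the factor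
  \<open>x\<^sub>a - y\<^sub>2\<^sub>k\<close> and new open variable \<open>x\<^sub>2\<^sub>k\<^sub>+\<^sub>1\<close>, or open and close, giving
  \<open>- \<lambda> (x\<^sub>a - x\<^sub>2\<^sub>k)\<close> and new open variable \<open>y\<^sub>2\<^sub>k\<^sub>+\<^sub>1\<close>. This is the recursion satisfied by the
  operator product.\<close>

section \<open>Adding an arc to a perfect matching and removing one\<close>

lemma perfect_matchingsI:
  assumes "m \<subseteq> S \<times> S" "\<And>a b. (a, b) \<in> m \<Longrightarrow> a < b"
    "\<And>i. i \<in> S \<Longrightarrow> \<exists>!q. q \<in> m \<and> (i = fst q \<or> i = snd q)"
  shows "m \<in> perfect_matchings S"
  using assms unfolding perfect_matchings_def by blast

lemma perfect_matchingsD: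
  assumes "m \<in> perfect_matchings S"
  shows "m \<subseteq> S \<times> S" "(a, b) \<in> m \<Longrightarrow> a < b"
    "i \<in> S \<Longrightarrow> \<exists>!q. q \<in> m \<and> (i = fst q \<or> i = snd q)"
  using assms unfolding perfect_matchings_def by blast+

lemma perfect_matchings_insert:
  assumes "m \<in> perfect_matchings S" "p < z" "p \<notin> S" "z \<notin> S"
  shows "insert (p, z) m \<in> perfect_matchings (insert p (insert z S))"
proof -
  note m = perfect_matchingsD[OF assms(1)]
  have "\<exists>!q. q \<in> insert (p, z) m \<and> (i = fst q \<or> i = snd q)" if "i \<in> insert p (insert z S)" for i
  proof (cases "i \<in> S")
    case True
    then obtain q where q: "q \<in> m" "i = fst q \<or> i = snd q"
      "\<And>q'. q' \<in> m \<Longrightarrow> i = fst q' \<or> i = snd q' \<Longrightarrow> q' = q"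
      using m(3)[OF True] by blast
    have "i \<noteq> p" "i \<noteq> z" using True assms by auto
    then have "q' = q" if "q' \<in> insert (p, z) m" "i = fst q' \<or> i = snd q'" for q'
    proof -
      have "q' \<noteq> (p, z)" using that(2) \<open>i \<noteq> p\<close> \<open>i \<noteq> z\<close> by auto
      then show ?thesis using q(3) that by blast
    qed
    then show ?thesis using q(1,2) by (intro ex1I[of _ q]) blast+
  next
    case False
    then have "\<not> (i = fst q \<or> i = snd q)" if "q \<in> m" for q using m(1) that by auto
    moreover have "i = p \<or> i = z" using False \<open>i \<in> _\<close> by auto
    ultimately show ?thesis by (intro ex1I[of _ "(p, z)"]) auto
  qed
  moreover have "insert (p, z) m \<subseteq> insert p (insert z S) \<times> insert p (insert z S)"
    using m(1) by blast
  moreover have "a < b" if "(a, b) \<in> insert (p, z) m" for a b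
    using that m(2) assms(2) by blast
  ultimately show "insert (p, z) m \<in> perfect_matchings (insert p (insert z S))"
    by (intro perfect_matchingsI)
qed

lemma perfect_matchings_remove:
  assumes "m \<in> perfect_matchings S" "(p, z) \<in> m"
  shows "m - {(p, z)} \<in> perfect_matchings (S - {p, z})"
proof -
  note m = perfect_matchingsD[OF assms(1)]
  have pz: "p \<in> S" "z \<in> S" using m(1) assms(2) by auto
  have uniq: "q = (p, z)" if "q \<in> m" "fst q \<in> {p, z} \<or> snd q \<in> {p, z}" for q
    using m(3)[OF pz(1)] m(3)[OF pz(2)] assms(2) that by (metis fst_conv insertE singletonD snd_conv)
  have "m - {(p, z)} \<subseteq> (S - {p, z}) \<times> (S - {p, z})"
  proof (rule subrelI)
    fix a b assume "(a, b) \<in> m - {(p, z)}"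
    then have "(a, b) \<in> m" "(a, b) \<noteq> (p, z)" by blast+
    then have "(a, b) \<in> S \<times> S" "a \<notin> {p, z}" "b \<notin> {p, z}"
      using m(1) uniq[of "(a, b)"] unfolding fst_conv snd_conv by blast+
    then show "(a, b) \<in> (S - {p, z}) \<times> (S - {p, z})" by blast
  qed
  moreover have "\<exists>!q. q \<in> m - {(p, z)} \<and> (i = fst q \<or> i = snd q)" if i: "i \<in> S - {p, z}" for i
  proof -
    obtain q where "q \<in> m" "i = fst q \<or> i = snd q"
      "\<And>q'. q' \<in> m \<Longrightarrow> i = fst q' \<or> i = snd q' \<Longrightarrow> q' = q"
      using m(3)[of i] i by blast
    moreover have "q \<noteq> (p, z)" using i \<open>i = fst q \<or> i = snd q\<close> by auto
    ultimately show ?thesis by (intro ex1I[of _ q]) blast+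
  qed
  ultimately show ?thesis using m(2) by (intro perfect_matchingsI) blast+
qed

lemma finite_perfect_matchings: "finite S \<Longrightarrow> finite (perfect_matchings S)"
  by (rule finite_subset[of _ "Pow (S \<times> S)"]) (auto simp: perfect_matchings_def)

section \<open>Matchings with prescribed open arcs\<close>

text \<open>\<open>L\<close> plays the role of the set of arcs that are still open after a prefix of the points
  has been read, and \<open>S\<close> of the set of points that remain to be read.\<close>

definition open_matchings :: "nat set \<Rightarrow> nat set \<Rightarrow> (nat \<times> nat) set set" where
  "open_matchings L S = {m \<in> perfect_matchings (L \<union> S). snd ` m \<inter> L = {}}"

lemma open_matchingsD:
  assumes "m \<in> open_matchings L S"
  shows "(a, b) \<in> m \<Longrightarrow> a \<in> L \<union> S" "(a, b) \<in> m \<Longrightarrow> b \<in> S" "(a, b) \<in> m \<Longrightarrow> a < b"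
proof -
  have pm: "m \<in> perfect_matchings (L \<union> S)" and sn: "snd ` m \<inter> L = {}"
    using assms by (simp_all add: open_matchings_def)
  note m = perfect_matchingsD[OF pm]
  show "a \<in> L \<union> S" if "(a, b) \<in> m" using m(1) that by blast
  show "b \<in> S" if "(a, b) \<in> m"
  proof -
    have "b \<in> L \<union> S" using m(1) that by blast
    moreover have "b \<in> snd ` m" using that by (metis image_eqI snd_conv)
    ultimately show ?thesis using sn by blast
  qed
  show "a < b" if "(a, b) \<in> m" using m(2) that .
qed

lemma finite_matching:
  assumes "m \<in> open_matchings L S" "finite L" "finite S"
  shows "finite m"
  using assms by (auto intro: finite_subset[of m "(L \<union> S) \<times> (L \<union> S)"] dest: open_matchingsD)

lemma finite_open_matchings: "finite L \<Longrightarrow> finite S \<Longrightarrow> finite (open_matchings L S)"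
  unfolding open_matchings_def by (simp add: finite_perfect_matchings)

text \<open>The partner of \<open>z\<close> lies either in \<open>S\<close>, so that
  \<open>z\<close> joins the open arcs, or in \<open>L\<close>, where no other smaller points exist,
  and then \<open>z\<close> closes that arc.\<close>

lemma open_matchings_insert:
  assumes "\<And>a. a \<in> L \<Longrightarrow> a < z" "\<And>b. b \<in> S \<Longrightarrow> z < b"
  shows "open_matchings L (insert z S) =
    open_matchings (insert z L) S \<union> (\<Union>p\<in>L. insert (p, z) ` open_matchings (L - {p}) S)"
    (is "?l = ?r")
proof
  have S: "z \<notin> L" "z \<notin> S" "L \<inter> S = {}"
    using assms by (force)+
  show "?l \<subseteq> ?r"
  proof
    fix m assume m: "m \<in> ?l"
    then have pm: "m \<in> perfect_matchings (L \<union> insert z S)" and sn: "snd ` m \<inter> L = {}"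
      by (auto simp: open_matchings_def)
    show "m \<in> ?r"
    proof (cases "z \<in> snd ` m")
      case True
      then obtain p where p: "(p, z) \<in> m" by force
      then have "p < z" "p \<in> L \<union> insert z S" using perfect_matchingsD(1,2)[OF pm] by blast+
      then have "p \<in> L" using assms(2) by force
      have "L \<union> insert z S - {p, z} = (L - {p}) \<union> S"
        using S \<open>p \<in> L\<close> by auto
      then have "m - {(p, z)} \<in> open_matchings (L - {p}) S"
        using perfect_matchings_remove[OF pm p] sn by (auto simp: open_matchings_def)
      moreover have "m = insert (p, z) (m - {(p, z)})" using p by auto
      ultimately show ?thesis using \<open>p \<in> L\<close> by blast
    next
      case False
      then show ?thesis using pm sn by (auto simp: open_matchings_def)
    qed
  qed
  show "?r \<subseteq> ?l"
  proof
    fix m assume "m \<in> ?r"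
    then consider "m \<in> open_matchings (insert z L) S"
      | p m' where "p \<in> L" "m = insert (p, z) m'" "m' \<in> open_matchings (L - {p}) S" by auto
    then show "m \<in> ?l"
    proof cases
      case 1
      then show ?thesis by (auto simp: open_matchings_def)
    next
      case (2 p m')
      have "m \<in> perfect_matchings (insert p (insert z (L - {p} \<union> S)))"
        unfolding 2(2) using 2 S assms(1)
        by (intro perfect_matchings_insert) (auto simp: open_matchings_def)
      moreover have "insert p (insert z (L - {p} \<union> S)) = L \<union> insert z S" using 2(1) by auto
      moreover have "p \<notin> snd ` m'" using open_matchingsD(2)[OF 2(3)] 2(1) S(3) by auto
      ultimately show ?thesis using 2 S by (auto simp: open_matchings_def)
    qed
  qed
qed

lemma open_matchings_opener:
  assumes "m \<in> open_matchings L S" "c \<in> L"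
  shows "\<exists>!d. (c, d) \<in> m"
proof -
  have "\<exists>!q. q \<in> m \<and> (c = fst q \<or> c = snd q)" "snd ` m \<inter> L = {}"
    using assms perfect_matchingsD(3)[of m "L \<union> S" c] by (simp_all add: open_matchings_def)
  moreover have "c \<noteq> snd q" if "q \<in> m" for q using \<open>snd ` m \<inter> L = {}\<close> assms(2) that by blast
  ultimately obtain q where q: "q \<in> m" "c = fst q" "\<And>q'. q' \<in> m \<Longrightarrow> c = fst q' \<Longrightarrow> q' = q"
    by blast
  have "d = snd q" if "(c, d) \<in> m" for d using q(3)[OF that] by auto
  moreover have "(c, snd q) \<in> m" using q(1,2) by simp
  ultimately show ?thesis by blast
qed

section \<open>Crossings and nestings created by closing an arc\<close>

text \<open>The arc \<open>(p, z)\<close> crosses exactly the open arcs opened after \<open>p\<close> and is nested in exactly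
  the ones opened before \<open>p\<close>.\<close>

lemma
  assumes m: "m \<in> open_matchings (L - {p}) S" and fin: "finite L" "finite S"
    and lt: "\<And>a. a \<in> L \<Longrightarrow> a < z" "\<And>b. b \<in> S \<Longrightarrow> z < b" and p: "p \<in> L"
  shows cross_insert: "cross (insert (p, z) m) = cross m + card {c \<in> L. p < c}"
    and nest_insert: "nest (insert (p, z) m) = nest m + card {c \<in> L. c < p}"
proof -
  let ?L = "L - {p}"
  note pm = open_matchingsD[OF m]
  have finm: "finite m" using finite_matching[OF m] fin by simp
  define d where "d c = (THE d. (c, d) \<in> m)" for c
  have d: "(c, d c) \<in> m" "d c \<in> S" and du: "\<And>e. (c, e) \<in> m \<Longrightarrow> e = d c" if "c \<in> ?L" for c
  proof -
    have ex1: "\<exists>!e. (c, e) \<in> m" using open_matchings_opener[OF m that] .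
    then show 1: "(c, d c) \<in> m" unfolding d_def by (rule theI')
    then show "d c \<in> S" using pm(2) by blast
    show "e = d c" if "(c, e) \<in> m" for e using 1 that ex1 by blast
  qed
  \<comment> \<open>Arcs starting after \<open>z\<close> neither cross nor enclose
    \<open>(p, z)\<close>, so only arcs from \<open>?L\<close> give new pairs.\<close>
  have fst_cases: "a \<in> ?L \<or> z < a" if "(a, b) \<in> m" for a b
    using pm(1)[OF that] lt(2) by blast
  have pz: "p < z" using p lt by auto
  let ?C = "\<lambda>m::(nat\<times>nat) set. {((a, b), (c, d)). (a, b) \<in> m \<and> (c, d) \<in> m \<and> a < c \<and> c < b \<and> b < d}"
  let ?N = "\<lambda>m::(nat\<times>nat) set. {((a, b), (c, d)). (a, b) \<in> m \<and> (c, d) \<in> m \<and> a < c \<and> c < d \<and> d < b}"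
  have finCN: "finite (?C m)" "finite (?N m)"
    by (rule finite_subset[of _ "m \<times> m"]; use finm in auto)+
  \<comment> \<open>All arcs of \<open>m\<close> close after \<open>z\<close>. Hence
    \<open>(p, z)\<close> can only be the first arc of a crossing and, below, only the inner arc of
    a nesting.\<close>
  have C: "?C (insert (p, z) m) = ?C m \<union> (\<lambda>c. ((p, z), (c, d c))) ` {c \<in> L. p < c}" (is "?l = ?r")
  proof
    show "?l \<subseteq> ?r"
    proof
      fix t assume "t \<in> ?l"
      then obtain a b c e where t: "t = ((a, b), (c, e))" "(a, b) \<in> insert (p, z) m"
        "(c, e) \<in> insert (p, z) m" "a < c" "c < b" "b < e" by auto
      then consider "(a, b) \<in> m" "(c, e) \<in> m" | "a = p" "b = z" "(c, e) \<in> m"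
        | "(a, b) \<in> m" "c = p" "e = z" by auto
      then show "t \<in> ?r"
      proof cases
        case 1
        then show ?thesis using t by auto
      next
        case 2
        then have "c \<in> ?L" using t fst_cases by force
        then show ?thesis using 2 t du[of c e] by auto
      next
        case 3
        then show ?thesis using t pm(2)[of a b] lt(2)[of b] by auto
      qed
    qed
    show "?r \<subseteq> ?l"
    proof
      fix t assume "t \<in> ?r"
      then consider "t \<in> ?C m" | c where "c \<in> L" "p < c" "t = ((p, z), (c, d c))" by auto
      then show "t \<in> ?l"
      proof cases
        case (2 c)
        then have "c \<in> ?L" by auto
        then show ?thesis using 2 d[of c] lt(1)[of c] lt(2)[of "d c"] pz by auto
      qed auto
    qed
  qed
  have N: "?N (insert (p, z) m) = ?N m \<union> (\<lambda>c. ((c, d c), (p, z))) ` {c \<in> L. c < p}" (is "?l = ?r")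
  proof
    show "?l \<subseteq> ?r"
    proof
      fix t assume "t \<in> ?l"
      then obtain a b c e where t: "t = ((a, b), (c, e))" "(a, b) \<in> insert (p, z) m"
        "(c, e) \<in> insert (p, z) m" "a < c" "c < e" "e < b" by auto
      then consider "(a, b) \<in> m" "(c, e) \<in> m" | "a = p" "b = z" "(c, e) \<in> m"
        | "(a, b) \<in> m" "c = p" "e = z" by auto
      then show "t \<in> ?r"
      proof cases
        case 1
        then show ?thesis using t by auto
      next
        case 2
        then show ?thesis using t pm(2)[of c e] lt(2)[of e] by auto
      next
        case 3
        then have "a \<in> ?L" using t fst_cases[of a b] pz by auto
        then show ?thesis using 3 t du[of a b] by auto
      qed
    qed
    show "?r \<subseteq> ?l"
    proof
      fix t assume "t \<in> ?r"
      then consider "t \<in> ?N m" | c where "c \<in> L" "c < p" "t = ((c, d c), (p, z))" by auto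
      then show "t \<in> ?l"
      proof cases
        case (2 c)
        then have "c \<in> ?L" by auto
        then show ?thesis using 2 d[of c] lt(1)[of c] lt(2)[of "d c"] pz by auto
      qed auto
    qed
  qed
  have pzm: "(p, z) \<notin> m" using pm(2)[of p z] lt(2)[of z] by auto
  show "cross (insert (p, z) m) = cross m + card {c \<in> L. p < c}"
    unfolding cross_def C using finCN fin pzm
    by (subst card_Un_disjoint) (auto simp: card_image inj_on_def)
  show "nest (insert (p, z) m) = nest m + card {c \<in> L. c < p}"
    unfolding nest_def N using finCN fin pzm
    by (subst card_Un_disjoint) (auto simp: card_image inj_on_def)
qed

section \<open>Weighted sums and the recursion for reading one point\<close>

definition open_Pf ::
    "'a::comm_ring_1 \<Rightarrow> (nat \<Rightarrow> nat \<Rightarrow> 'a) \<Rightarrow> nat set \<Rightarrow> nat set \<Rightarrow> 'a" where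
  "open_Pf l A L S =
     (\<Sum>m\<in>open_matchings L S.
        (-1) ^ cross m * l ^ (cross m + nest m) * (\<Prod>(i, j)\<in>m. A i j))"

lemma Pf_eq_open_Pf: "Pf l n A = open_Pf l A {} {1..2 * n}"
  by (simp add: Pf_def open_Pf_def open_matchings_def)

lemma open_Pf_empty: "open_Pf l A L {} = (if L = {} then 1 else 0)"
proof (cases "L = {}")
  case True
  have "open_matchings {} {} = {{}}"
    by (auto simp: open_matchings_def perfect_matchings_def)
  then show ?thesis using True by (simp add: open_Pf_def cross_def nest_def case_prod_unfold)
next
  case False
  then have "open_matchings L {} = {}"
    using open_matchings_opener[of _ L "{}"] open_matchingsD(2)[of _ L "{}"] by blast
  then show ?thesis using False by (simp add: open_Pf_def)
qed

text \<open>New crossings and nestings together number \<open>card L - 1\<close> whichever arc is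
  closed, so the power of \<open>l\<close> factors out and only the sign depends on
  \<open>p\<close>. For empty \<open>L\<close> the truncated subtraction is harmless because the sum
  is empty.\<close>

lemma open_Pf_insert:
  assumes fin: "finite L" "finite S"
    and lt: "\<And>a. a \<in> L \<Longrightarrow> a < z" "\<And>b. b \<in> S \<Longrightarrow> z < b"
  shows "open_Pf l A L (insert z S) = open_Pf l A (insert z L) S +
    l ^ (card L - 1) * (\<Sum>p\<in>L. (-1) ^ card {c \<in> L. p < c} * A p z * open_Pf l A (L - {p}) S)"
proof -
  let ?w = "\<lambda>m. (-1) ^ cross m * l ^ (cross m + nest m) * (\<Prod>(i, j)\<in>m. A i j)"
  let ?I = "\<lambda>p. insert (p, z) ` open_matchings (L - {p}) S"
  have nz: "(q, z) \<notin> m" if "m \<in> open_matchings (L - {p}) S" for p q m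
    using open_matchingsD(2)[OF that] lt(2) by blast
  have disj: "?I p \<inter> ?I q = {}" if "p \<noteq> q" for p q
  proof -
    have False if "insert (p, z) m = insert (q, z) m'" "m' \<in> open_matchings (L - {q}) S" for m m'
      using that nz[OF that(2), of p] \<open>p \<noteq> q\<close> by blast
    then show ?thesis by blast
  qed
  \<comment> \<open>\<open>z\<close> is never a right endpoint in the first family and always one in
    the others.\<close>
  have disj0: "open_matchings (insert z L) S \<inter> (\<Union>p\<in>L. ?I p) = {}"
    by (fastforce simp: open_matchings_def)
  have closed: "sum ?w (?I p) = l ^ (card L - 1) *
      ((-1) ^ card {c \<in> L. p < c} * A p z * open_Pf l A (L - {p}) S)" if p: "p \<in> L" for p
  proof -
    have inj: "inj_on (insert (p, z)) (open_matchings (L - {p}) S)"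
      using nz by (intro inj_onI) (metis insert_ident)
    have card: "card {c \<in> L. p < c} + card {c \<in> L. c < p} = card L - 1"
    proof -
      have "L - {p} = {c \<in> L. p < c} \<union> {c \<in> L. c < p}" by auto
      then have "card (L - {p}) = card {c \<in> L. p < c} + card {c \<in> L. c < p}"
        using fin by (simp add: card_Un_disjoint disjoint_iff)
      then show ?thesis using p by simp
    qed
    have "?w (insert (p, z) m) = l ^ (card L - 1) * ((-1) ^ card {c \<in> L. p < c} * A p z * ?w m)"
      if m: "m \<in> open_matchings (L - {p}) S" for m
    proof -
      have "finite m" using finite_matching[OF m] fin by simp
      then have "(\<Prod>(i, j)\<in>insert (p, z) m. A i j) = A p z * (\<Prod>(i, j)\<in>m. A i j)"
        using nz[OF m] by simp
      moreover have "cross (insert (p, z) m) + nest (insert (p, z) m) =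
          cross m + nest m + (card L - 1)"
        using cross_insert[OF m fin lt p] nest_insert[OF m fin lt p] card by simp
      ultimately show ?thesis
        using cross_insert[OF m fin lt p] by (simp add: power_add algebra_simps)
    qed
    then show ?thesis
      unfolding sum.reindex[OF inj] open_Pf_def sum_distrib_left by (intro sum.cong) auto
  qed
  have matchings: "open_matchings L (insert z S) =
      open_matchings (insert z L) S \<union> (\<Union>p\<in>L. ?I p)"
    using lt by (rule open_matchings_insert)
  have "open_Pf l A L (insert z S) =
      sum ?w (open_matchings (insert z L) S) + sum ?w (\<Union>p\<in>L. ?I p)"
    unfolding open_Pf_def matchings
    by (rule sum.union_disjoint) (use fin disj0 in \<open>auto simp: finite_open_matchings\<close>)
  also have "sum ?w (\<Union>p\<in>L. ?I p) = (\<Sum>p\<in>L. sum ?w (?I p))"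
    by (rule sum.UNION_disjoint) (use fin disj in \<open>auto simp: finite_open_matchings\<close>)
  finally show ?thesis
    by (simp add: closed sum_distrib_left open_Pf_def)
qed

lemma open_Pf_atLeast:
  assumes "z \<le> N" "finite L" "\<And>a. a \<in> L \<Longrightarrow> a < z"
  shows "open_Pf l A L {z..N} = open_Pf l A (insert z L) {Suc z..N} +
    l ^ (card L - 1) *
      (\<Sum>p\<in>L. (-1) ^ card {c \<in> L. p < c} * A p z * open_Pf l A (L - {p}) {Suc z..N})"
  using open_Pf_insert[of L "{Suc z..N}" z l A] assms
  by (simp add: Icc_eq_insert_lb_nat)

section \<open>Entries \<open>x i - y j\<close>: the shape of the partial sums\<close>

locale difference_entries =
  fixes l :: "'a::comm_ring_1" and x y :: "nat \<Rightarrow> 'a" and N :: nat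
begin

abbreviation F :: "nat set \<Rightarrow> nat \<Rightarrow> 'a" where
  "F L z \<equiv> open_Pf l (\<lambda>i j. x i - y j) L {z..N}"

lemma F_0: "z \<le> N \<Longrightarrow> F {} z = F {z} (Suc z)"
  by (subst open_Pf_atLeast) auto

lemma F_1: "z \<le> N \<Longrightarrow> a < z \<Longrightarrow> F {a} z = F {a, z} (Suc z) + (x a - y z) * F {} (Suc z)"
  by (subst open_Pf_atLeast) (auto simp: insert_commute Collect_conv_if)

lemma F_2:
  assumes "z \<le> N" "a < b" "b < z"
  shows "F {a, b} z = F {a, b, z} (Suc z) +
    l * ((x b - y z) * F {a} (Suc z) - (x a - y z) * F {b} (Suc z))"
proof -
  have "{c \<in> {a, b}. a < c} = {b}" "{c \<in> {a, b}. b < c} = {}"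
    "{a, b} - {a} = {b}" "{a, b} - {b} = {a}" "insert z {a, b} = {a, b, z}"
    using assms by auto
  note sets = this
  have "sum f {a, b} = f a + f b" for f :: "nat \<Rightarrow> 'a" using assms by simp
  note sum = this
  have "card {a, b} - 1 = 1" using assms by simp
  note card = this
  have "F {a, b} z = F (insert z {a, b}) (Suc z) + l ^ (card {a, b} - 1) *
      (\<Sum>p\<in>{a, b}. (-1) ^ card {c \<in> {a, b}. p < c} * (x p - y z) * F ({a, b} - {p}) (Suc z))"
    using assms by (intro open_Pf_atLeast) auto
  then show ?thesis unfolding sum card sets by (simp add: algebra_simps)
qed

lemma F_3:
  assumes "z \<le> N" "a < b" "b < c" "c < z"
  shows "F {a, b, c} z = F {a, b, c, z} (Suc z) +
    l\<^sup>2 * ((x c - y z) * F {a, b} (Suc z) - (x b - y z) * F {a, c} (Suc z)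
      + (x a - y z) * F {b, c} (Suc z))"
proof -
  have "{d \<in> {a, b, c}. a < d} = {b, c}" "{d \<in> {a, b, c}. b < d} = {c}"
    "{d \<in> {a, b, c}. c < d} = {}"
    "{a, b, c} - {a} = {b, c}" "{a, b, c} - {b} = {a, c}" "{a, b, c} - {c} = {a, b}"
    "insert z {a, b, c} = {a, b, c, z}"
    using assms by auto
  note sets = this
  have "sum f {a, b, c} = f a + f b + f c" for f :: "nat \<Rightarrow> 'a"
    using assms by (simp add: add.assoc)
  note sum = this
  have "card {a, b, c} - 1 = 2" "card {b, c} = 2" using assms by simp_all
  note card = this
  have "F {a, b, c} z = F (insert z {a, b, c}) (Suc z) + l ^ (card {a, b, c} - 1) *
      (\<Sum>p\<in>{a, b, c}. (-1) ^ card {d \<in> {a, b, c}. p < d} * (x p - y z)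
        * F ({a, b, c} - {p}) (Suc z))"
    using assms by (intro open_Pf_atLeast) auto
  then show ?thesis unfolding sum card sets by (simp add: card algebra_simps)
qed

text \<open>Induction runs downwards from the state with no points left. Closing one of two arcs
  antisymmetrizes an affine function, which leaves a multiple of \<open>x a - x b\<close>; for three
  arcs the alternating sum of such multiples cancels.\<close>

lemma F_affine:
  assumes "z \<le> Suc N"
  shows "(\<exists>\<alpha> \<beta>. \<forall>a<z. F {a} z = \<alpha> * x a + \<beta>) \<and>
    (\<exists>\<gamma>. \<forall>a b. a < b \<longrightarrow> b < z \<longrightarrow> F {a, b} z = \<gamma> * (x a - x b)) \<and>
    (\<forall>L. finite L \<longrightarrow> (\<forall>a\<in>L. a < z) \<longrightarrow> 3 \<le> card L \<longrightarrow> F L z = 0)"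
  using assms
proof (induction z rule: inc_induct)
  case base
  then show ?case by (auto simp: open_Pf_empty intro: exI[of _ 0])
next
  case (step z)
  then have z: "z \<le> N" by simp
  obtain \<alpha> \<beta> where F1: "\<And>a. a < Suc z \<Longrightarrow> F {a} (Suc z) = \<alpha> * x a + \<beta>"
    using step.IH by auto
  obtain \<gamma> where F2: "\<And>a b. a < b \<Longrightarrow> b < Suc z \<Longrightarrow> F {a, b} (Suc z) = \<gamma> * (x a - x b)"
    using step.IH by auto
  have F3: "F L (Suc z) = 0" if "finite L" "\<And>a. a \<in> L \<Longrightarrow> a < Suc z" "3 \<le> card L" for L
    using step.IH that by auto
  show ?case
  proof (intro conjI allI impI exI)
    fix a assume "a < z"
    then show "F {a} z = (\<gamma> + F {} (Suc z)) * x a + (- \<gamma> * x z - y z * F {} (Suc z))"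
      using F_1[OF z] F2[of a z] by (simp add: algebra_simps)
  next
    fix a b assume ab: "a < b" "b < z"
    have "F {a, b, z} (Suc z) = 0" using ab by (intro F3) auto
    \<comment> \<open>In the difference of the two closing terms,
      \<open>\<alpha> * x a * x b\<close> and \<open>\<beta> * y z\<close> cancel.\<close>
    then show "F {a, b} z = (- l * (\<beta> + \<alpha> * y z)) * (x a - x b)"
      using F_2[OF z ab] F1[of a] F1[of b] ab by (simp add: algebra_simps)
  next
    fix L :: "nat set" assume L: "finite L" "\<forall>a\<in>L. a < z" "3 \<le> card L"
    have open0: "F (insert z L) (Suc z) = 0"
      using L by (intro F3) (auto simp: card_insert_if intro: less_SucI)
    show "F L z = 0"
    proof (cases "card L = 3")
      case False
      \<comment> \<open>Closing one of at least four arcs leaves at least three.\<close>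
      have "F (L - {p}) (Suc z) = 0" if "p \<in> L" for p
        using L False that by (intro F3) (auto intro: less_SucI)
      then show ?thesis using L z open0 by (subst open_Pf_atLeast) auto
    next
      case True
      \<comment> \<open>Sorting \<open>L\<close> as \<open>a < b < c\<close> gives the order that
        \<open>F_3\<close> requires.\<close>
      define a where "a = Min L"
      define c where "c = Max L"
      have ac: "a \<in> L" "c \<in> L" "\<forall>d\<in>L. a \<le> d \<and> d \<le> c" 
        unfolding a_def c_def using L by (auto intro!: Min_in Max_in)
      have "a \<noteq> c"
      proof
        assume "a = c"
        then have "L \<subseteq> {a}" using ac by auto
        then show False using True card_mono[of "{a}" L] by auto
      qed
      then have "card (L - {a, c}) = 1" using L True ac by (simp add: card_Diff_subset)
      then obtain b where b: "L - {a, c} = {b}" by (auto simp: card_1_singleton_iff)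
      then have Leq: "L = {a, b, c}" and "b \<in> L" "b \<noteq> a" "b \<noteq> c" using ac by auto
      then have lt: "a < b" "b < c" using ac(3) by (metis le_neq_implies_less)+
      have "c < z" using ac L by auto
      \<comment> \<open>The closing terms vanish by \<open>(x c - y z) * (x a - x b) - (x b - y z) *
        (x a - x c) + (x a - y z) * (x b - x c) = 0\<close>.\<close>
      then show ?thesis
        using F_3[OF z lt] open0 lt F2[of a b] F2[of a c] F2[of b c] unfolding Leq
        by (simp add: insert_commute algebra_simps)
    qed
  qed
qed

section \<open>Reading two points at a time\<close>

text \<open>\<open>R k m a\<close> is the value of a state that has one open arc with variable \<open>a\<close> just before
  point \<open>2k\<close>, when the last point is \<open>2(k + m)\<close>.\<close>

fun R :: "nat \<Rightarrow> nat \<Rightarrow> 'a \<Rightarrow> 'a" where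
  "R k 0 a = a - y (2 * k)"
| "R k (Suc m) a = (a - y (2 * k)) * R (Suc k) m (x (2 * k + 1))
     - l * (a - x (2 * k)) * R (Suc k) m (y (2 * k + 1))"

text \<open>The tails of the recursion are evaluated at fixed variables, so \<open>a\<close> enters
  only through the leading factors.\<close>

lemma R_affine: "\<exists>\<alpha> \<beta>. \<forall>a. R k m a = \<alpha> * a + \<beta>"
proof (cases m)
  case 0
  then show ?thesis by (intro exI[of _ 1] exI[of _ "- y (2 * k)"]) simp
next
  case (Suc m')
  let ?u = "R (Suc k) m' (x (2 * k + 1))" and ?v = "l * R (Suc k) m' (y (2 * k + 1))"
  show ?thesis
    by (intro exI[of _ "?u - ?v"] exI[of _ "x (2 * k) * ?v - y (2 * k) * ?u"])
      (simp add: Suc algebra_simps)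
qed

lemma F_eq_R: "N = 2 * (k + m) \<Longrightarrow> a < 2 * k \<Longrightarrow> F {a} (2 * k) = R k m (x a)"
proof (induction m arbitrary: k a)
  case 0
  then show ?case using F_1[of "2 * k" a] by (simp add: open_Pf_empty)
next
  case (Suc m)
  have IH: "F {b} (Suc (Suc (2 * k))) = R (Suc k) m (x b)" if "b < 2 * k + 2" for b
    using Suc.IH[of "Suc k" b] Suc.prems that by simp
  have le: "2 * k \<le> N" "2 * k + 1 \<le> N" "2 * k + 2 \<le> Suc N" using Suc.prems by auto
  \<comment> \<open>Once \<open>2 * k\<close> has closed the only open arc, the next point must open
    one.\<close>
  have closed: "F {} (Suc (2 * k)) = R (Suc k) m (x (2 * k + 1))"
    using F_0[of "2 * k + 1"] IH[of "2 * k + 1"] le by simp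
  have three: "F {a, 2 * k, Suc (2 * k)} (Suc (Suc (2 * k))) = 0"
    using F_affine[OF le(3)] Suc.prems by (auto elim!: allE[of _ "{a, 2 * k, Suc (2 * k)}"])
  obtain \<alpha> \<beta> where R: "\<And>b. R (Suc k) m b = \<alpha> * b + \<beta>" using R_affine by metis
  \<comment> \<open>The two ways of closing at \<open>2 * k + 1\<close> leave the factor
    \<open>\<beta> + \<alpha> * y (2 * k + 1)\<close>, which is the affine function \<open>R\<close>
    evaluated at \<open>y (2 * k + 1)\<close>.\<close>
  have "F {a, 2 * k} (Suc (2 * k)) = - l * (x a - x (2 * k)) * R (Suc k) m (y (2 * k + 1))"
    using F_2[of "2 * k + 1" a "2 * k"] le Suc.prems three IH[of a] IH[of "2 * k"]
    by (simp add: R algebra_simps)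
  then show ?case using F_1[of "2 * k" a] le Suc.prems closed by (simp add: algebra_simps)
qed

end

text \<open>The first point can only open an arc, so the recursion starts at point 2 with open
  variable \<open>x 1\<close>.\<close>

lemma Pf_eq_R:
  "Pf l (Suc m) (\<lambda>i j. x i - y j) = difference_entries.R l x y 1 m (x 1)"
proof -
  interpret difference_entries l x y "2 * Suc m" .
  show ?thesis using F_0[of 1] F_eq_R[of 1 m 1] by (simp add: Pf_eq_open_Pf numeral_2_eq_2)
qed

section \<open>The operator product\<close>

text \<open>\<open>R\<close> does not depend on \<open>N\<close>, so \<open>0\<close> is an arbitrary choice.\<close>

interpretation mpol: difference_entries lam X Y 0 .

lemma sigma_diff: "sigma k (p - q) = sigma k p - sigma k q"
  using sigma_add[of k "p - q" q] by (simp add: algebra_simps)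

lemma sigma_lam: "sigma k lam = lam"
  by (simp add: lam_def sigma_cst)

lemmas sigma_simps = sigma_diff sigma_mult sigma_lam sigma_x sigma_y

text \<open>\<open>sigma (2 * j)\<close> moves only \<open>X (2 * j + 1)\<close> and
  \<open>Y (2 * j)\<close>, while the recursion from \<open>k\<close> brings in only indices from
  \<open>2 * k\<close> on.\<close>

lemma sigma_R: "j < k \<Longrightarrow> sigma (2 * j) (mpol.R k m a) = mpol.R k m (sigma (2 * j) a)"
proof (induction m arbitrary: k a)
  case 0
  then show ?case by (simp add: sigma_simps)
next
  case (Suc m)
  then show ?case by (simp add: sigma_simps)
qed

abbreviation apply_ops :: "nat list \<Rightarrow> mpol \<Rightarrow> mpol" where
  "apply_ops ks \<equiv> foldr (\<circ>) (map (\<lambda>k p. p - lam * sigma (2 * k) p) ks) id"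

text \<open>Each operator is linear over the elements that its \<open>sigma\<close> fixes.\<close>

lemma apply_ops_mult:
  "(\<And>k. k \<in> set ks \<Longrightarrow> sigma (2 * k) c = c) \<Longrightarrow> apply_ops ks (c * p) = c * apply_ops ks p"
  by (induction ks) (simp_all add: sigma_mult algebra_simps)

text \<open>The operator with the smallest index acts last. The others fix the leading factor and,
  by induction, turn the remaining product into \<open>mpol.R\<close>; the last one then yields the
  two terms of the recursion.\<close>

lemma apply_ops_eq_R:
  "1 \<le> k \<Longrightarrow> apply_ops [k..<k + m] (\<Prod>i = k..k + m. X (2 * i - 1) - Y (2 * i)) =
    mpol.R k m (X (2 * k - 1))"
proof (induction m arbitrary: k)
  case 0
  then show ?case by simp
next
  case (Suc m)
  let ?P = "\<Prod>i = Suc k..Suc k + m. X (2 * i - 1) - Y (2 * i)"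
  let ?Q = "(X (2 * k - 1) - Y (2 * k)) * mpol.R (Suc k) m (X (2 * k + 1))"
  have eq: "2 * k + 1 = 2 * Suc k - 1" by simp
  have IH: "apply_ops [Suc k..<Suc k + m] ?P = mpol.R (Suc k) m (X (2 * k + 1))"
    unfolding eq by (rule Suc.IH) simp
  have fixed: "sigma (2 * j) (X (2 * k - 1) - Y (2 * k)) = X (2 * k - 1) - Y (2 * k)"
    if "j \<in> set [Suc k..<Suc k + m]" for j
    using that by (auto simp: sigma_simps)
  have list: "[k..<k + Suc m] = k # [Suc k..<Suc k + m]"
    by (simp add: upt_conv_Cons)
  have prod: "(\<Prod>i = k..k + Suc m. X (2 * i - 1) - Y (2 * i)) = (X (2 * k - 1) - Y (2 * k)) * ?P"
    by (subst prod.atLeast_Suc_atMost) auto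
  have "apply_ops (k # ks) p = apply_ops ks p - lam * sigma (2 * k) (apply_ops ks p)" for ks p
    by simp
  then have "apply_ops [k..<k + Suc m] (\<Prod>i = k..k + Suc m. X (2 * i - 1) - Y (2 * i)) =
      ?Q - lam * sigma (2 * k) ?Q"
    unfolding list prod by (simp only: apply_ops_mult[OF fixed] IH)
  \<comment> \<open>\<open>Y (2 * k)\<close> becomes \<open>X (2 * k)\<close> in the leading factor,
    and the open variable \<open>X (2 * k + 1)\<close> of the tail becomes
    \<open>Y (2 * k + 1)\<close>.\<close>
  also have "sigma (2 * k) ?Q =
      (X (2 * k - 1) - X (2 * k)) * mpol.R (Suc k) m (Y (2 * k + 1))"
  proof -
    have "2 * k - 1 \<noteq> 2 * k + 1" using Suc.prems by simp
    then show ?thesis by (simp add: sigma_simps sigma_R)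
  qed
  also have "?Q - lam * \<dots> = mpol.R k (Suc m) (X (2 * k - 1))"
    by (simp add: algebra_simps)
  finally show ?case .
qed

theorem theorem6:
  fixes n :: nat
  assumes "n \<ge> 1"
  shows "Pf lam n (\<lambda>i j. X i - Y j) =
         foldr (\<circ>) (map (\<lambda>k p. p - lam * sigma (2 * k) p) [1..<n]) id
           (\<Prod>i = 1..n. X (2 * i - 1) - Y (2 * i))"
proof -
  obtain m where n: "n = Suc m" using assms by (cases n) auto
  show ?thesis using apply_ops_eq_R[of 1 m] by (simp add: n Pf_eq_R del: upt_Suc)
qed

end
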